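(* Let $\Sigma$ be a nonempty set (of arbitrary, possibly infinite, cardinality) and let $n$ be a positive integer. Let $M:\Sigma^{n-1}\to\Sigma$ be an $(n-1)$-quasigroup, viewed through its $n$-ary predicate $M\langle z_1,\ldots,z_n\rangle$. Let $K:\Sigma^{k-1}\to\Sigma$ be an irreducible retract of $M$ whose arity is maximal among all irreducible retracts of $M$ (so that $3\le k\le n-1$). Suppose $4\le k\le n-3$. Then there exist nonempty pairwise disjoint collections $\bar z^1,\ldots,\bar z^k$ of variables from $\bar z=(z_1,\ldots,z_n)$ and multary quasigroups $q^1,\ldots,q^k$ (with $q^i$ of arity equal to the length of $\bar z^i$) such that for all $\bar z\in\Sigma^n$, $$M\langle \bar z\rangle \iff K\big\langle q^1(\bar z^1),\ldots,q^k(\bar z^k)\big\rangle .$$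
   Context: An $n$-ary operation $q:\Sigma^n\to\Sigma$ is an $n$-quasigroup if in the equality $q(x_1,\ldots,x_n)=x_{n+1}$ knowledge of any $n$ of the elements $x_1,\ldots,x_{n+1}$ uniquely determines the remaining one (a $1$-quasigroup is a permutation of $\Sigma$). Its predicate is the $(n+1)$-ary relation $q\langle x_1,\ldots,x_n,x_{n+1}\rangle :\iff q(x_1,\ldots,x_n)=x_{n+1}$. An $(n-1)$-quasigroup $M$ is reducible if there exist a permutation $\eta$ of $\{1,\ldots,n\}$, an integer $j$ with $2\le j\le n-2$, a $j$-quasigroup $q$ and an $(n-j)$-quasigroup $K$ with $M\langle x_1,\ldots,x_n\rangle\iff K\langle q(x_{\eta(1)},\ldots,x_{\eta(j)}),x_{\eta(j+1)},\ldots,x_{\eta(n)}\rangle$ for all $x_i\in\Sigma$; otherwise it is irreducible (in particular all $0$-, $1$- and $2$-quasigroups are irreducible). If an $l$-ary predicate is obtained from the $n$-ary predicate $M\langle\cdot\rangle$ by fixing the values of $n-l>0$ of its arguments (any of the $n$ positions may be fixed), it is the predicate of an $(l-1)$-quasigroup, called a retract of $M$. The arity of a retract means its arity as a quasigroup; in the statement, $K$ as a $(k-1)$-quasigroup has a $k$-ary predicate. *)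

theory Defs
  imports Main "HOL-Combinatorics.Permutations"
begin

text \<open>
  The alphabet is the type \<open>'a\<close>. An \<open>m\<close>-ary operation is a function \<open>'a list \<Rightarrow> 'a\<close> of which only
  the values on lists of length \<open>m\<close> matter. Positions are counted from 0, and the arity \<open>m\<close> in the
  definitions below is always that of the operation, so the associated predicate is considered
  on lists of length \<open>Suc m\<close>.
\<close>

definition qpred :: "('a list \<Rightarrow> 'a) \<Rightarrow> 'a list \<Rightarrow> bool" where
  "qpred q xs \<longleftrightarrow> q (butlast xs) = last xs"

definition quasigroup :: "nat \<Rightarrow> ('a list \<Rightarrow> 'a) \<Rightarrow> bool" where
  "quasigroup m q \<longleftrightarrow>
     (\<forall>xs i. length xs = Suc m \<longrightarrow> i < Suc m \<longrightarrow> (\<exists>!y. qpred q (xs[i := y])))"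

definition reducible :: "nat \<Rightarrow> ('a list \<Rightarrow> 'a) \<Rightarrow> bool" where
  "reducible m M \<longleftrightarrow>
     (\<exists>\<eta> j q K. \<eta> permutes {..<Suc m} \<and> 2 \<le> j \<and> j + 2 \<le> Suc m \<and>
        quasigroup j q \<and> quasigroup (Suc m - j) K \<and>
        (\<forall>xs. length xs = Suc m \<longrightarrow>
           (qpred M xs \<longleftrightarrow>
            qpred K (q (map (\<lambda>i. xs ! \<eta> i) [0..<j]) # map (\<lambda>i. xs ! \<eta> i) [j..<Suc m]))))"

definition irreducible_quasigroup :: "nat \<Rightarrow> ('a list \<Rightarrow> 'a) \<Rightarrow> bool" where
  "irreducible_quasigroup m M \<longleftrightarrow> quasigroup m M \<and> \<not> reducible m M"

text \<open>
  In a retract, \<open>I\<close> is the set of free positions (which keep their order) and the list \<open>as\<close> supplies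
  the values at the fixed ones. At least one position is fixed, so \<open>M\<close> is not a retract of itself.
\<close>

definition retract :: "nat \<Rightarrow> ('a list \<Rightarrow> 'a) \<Rightarrow> nat \<Rightarrow> ('a list \<Rightarrow> 'a) \<Rightarrow> bool" where
  "retract m M l K \<longleftrightarrow>
     l < m \<and> quasigroup l K \<and>
     (\<exists>I as. I \<subseteq> {..<Suc m} \<and> card I = Suc l \<and> length as = Suc m \<and>
        (\<forall>xs. length xs = Suc m \<longrightarrow> (\<forall>i<Suc m. i \<notin> I \<longrightarrow> xs ! i = as ! i) \<longrightarrow>
           (qpred K (nths xs I) \<longleftrightarrow> qpred M xs)))"

definition maximal_irreducible_retract ::
    "nat \<Rightarrow> ('a list \<Rightarrow> 'a) \<Rightarrow> nat \<Rightarrow> ('a list \<Rightarrow> 'a) \<Rightarrow> bool" where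
  "maximal_irreducible_retract m M l K \<longleftrightarrow>
     retract m M l K \<and> irreducible_quasigroup l K \<and>
     (\<forall>l' K'. retract m M l' K' \<and> irreducible_quasigroup l' K' \<longrightarrow> l' \<le> l)"

end

theory Submission
  imports Defs
begin

text \<open>
  Write \<open>V\<close> for the set of all positions and \<open>I\<close> for the \<open>k\<close> free positions of \<open>K\<close>. Freeing one
  more position \<open>j\<close> gives a reducible retract, and irreducibility of \<open>K\<close> forces its decomposition
  to be \<open>{i, j}\<close> against the rest, for an \<open>i \<in> I\<close> that is unique because \<open>k \<ge> 4\<close>. Hence changing
  the value at \<open>j\<close> amounts to permuting the values at \<open>i\<close>; in particular every retract with free
  positions \<open>I\<close> is isotopic to \<open>K\<close>. Freeing two positions \<open>j, j'\<close> still gives a proper, reducible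
  retract, and its decomposition shows that \<open>i\<close> does not depend on the fixed values, and that the
  permutation at \<open>i\<close> caused by \<open>j\<close> does not depend on the value at \<open>j'\<close> unless \<open>j'\<close> belongs to
  the same \<open>i\<close>. Resetting the positions outside \<open>I\<close> one at a time then gives the operations \<open>q\<^sup>i\<close>,
  one for each block of an \<open>i \<in> I\<close> and the positions that belong to it.
\<close>

section \<open>Decompositions of a predicate as exchange properties\<close>

text \<open>
  With the positions outside \<open>F\<close> fixed as in \<open>c\<close>, the predicate has the form \<open>f x\<^sub>A = g x\<^sub>B\<close> with
  \<open>B = F - A\<close> iff the relation between \<open>x\<^sub>A\<close> and \<open>x\<^sub>B\<close> is difunctional: three of the four points
  \<open>(x\<^sub>A, x\<^sub>B)\<close>, \<open>(y\<^sub>A, x\<^sub>B)\<close>, \<open>(x\<^sub>A, y\<^sub>B)\<close>, \<open>(y\<^sub>A, y\<^sub>B)\<close> force the fourth.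
\<close>

definition splits :: "(('i \<Rightarrow> 'a) \<Rightarrow> bool) \<Rightarrow> 'i set \<Rightarrow> 'i set \<Rightarrow> ('i \<Rightarrow> 'a) \<Rightarrow> bool" where
  "splits P F A c \<longleftrightarrow> (\<forall>x y. (\<forall>v. v \<notin> F \<longrightarrow> x v = c v \<and> y v = c v) \<longrightarrow>
     P x \<longrightarrow> P (override_on x y A) \<longrightarrow> P (override_on y x A) \<longrightarrow> P y)"

lemma splitsD:
  assumes "splits P F A c" "\<And>v. v \<notin> F \<Longrightarrow> x v = c v" "\<And>v. v \<notin> F \<Longrightarrow> y v = c v"
    and "P x" "P (override_on x y A)" "P (override_on y x A)"
  shows "P y"
  using assms unfolding splits_def by blast

text \<open>As \<open>x\<close> and \<open>y\<close> agree off \<open>F\<close>, overriding on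
  \<open>F - A\<close> instead of \<open>A\<close> merely swaps the two mixed points.\<close>

lemma splits_complement:
  assumes "splits P F A c" "A \<subseteq> F"
  shows "splits P F (F - A) c"
  unfolding splits_def
proof (intro allI impI)
  fix x y
  assume eq: "\<forall>v. v \<notin> F \<longrightarrow> x v = c v \<and> y v = c v"
    and P: "P x" "P (override_on x y (F - A))" "P (override_on y x (F - A))"
  have "override_on x y (F - A) = override_on y x A" "override_on y x (F - A) = override_on x y A"
    using eq assms(2) by (auto simp: override_on_def fun_eq_iff)
  with P eq show "P y"
    using splitsD[OF assms(1), of x y] by simp
qed

text \<open>Fixing more positions leaves fewer admissible \<open>x\<close> and \<open>y\<close>;
  these agree off \<open>F'\<close>, so overriding on \<open>A\<close> acts only on
  \<open>A \<inter> F'\<close>.\<close>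

lemma splits_restrict:
  assumes "splits P F A c" "F' \<subseteq> F" "\<And>v. v \<notin> F \<Longrightarrow> c' v = c v"
  shows "splits P F' (A \<inter> F') c'"
  unfolding splits_def
proof (intro allI impI)
  fix x y
  assume eq: "\<forall>v. v \<notin> F' \<longrightarrow> x v = c' v \<and> y v = c' v"
    and P: "P x" "P (override_on x y (A \<inter> F'))" "P (override_on y x (A \<inter> F'))"
  have "override_on x y (A \<inter> F') = override_on x y A" "override_on y x (A \<inter> F') = override_on y x A"
    using eq by (auto simp: override_on_def fun_eq_iff)
  moreover have "x v = c v" "y v = c v" if "v \<notin> F" for v
    using eq assms(2,3) that by auto
  ultimately show "P y"
    using P splitsD[OF assms(1), of x y] by simp
qed

text \<open>\<open>x\<close> shows that the pairs \<open>(x m, x j)\<close> and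
  \<open>(t, w)\<close> contribute equally to the equation behind the split, so they are
  interchangeable in every \<open>y\<close> of the same context that carries the first pair.\<close>

lemma splits_exchange:
  assumes "splits P F {m, j} c" "m \<in> F" "j \<in> F" "m \<noteq> j"
    and eq: "\<And>v. v \<notin> F \<Longrightarrow> x v = c v" "\<And>v. v \<notin> F \<Longrightarrow> y v = c v"
    and xy: "x m = y m" "x j = y j"
    and P: "P x" "P (x(m := t, j := w))"
  shows "P y \<longleftrightarrow> P (y(m := t, j := w))"
proof
  assume "P y"
  have *: "override_on x (y(m := t, j := w)) {m, j} = x(m := t, j := w)"
    "override_on (y(m := t, j := w)) x {m, j} = y"
    using xy \<open>m \<noteq> j\<close> by (auto simp: override_on_def fun_eq_iff)
  show "P (y(m := t, j := w))"
    by (rule splitsD[OF assms(1), of x]) (use * P \<open>P y\<close> eq assms(2,3) in auto)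
next
  assume "P (y(m := t, j := w))"
  have *: "override_on (x(m := t, j := w)) y {m, j} = x"
    "override_on y (x(m := t, j := w)) {m, j} = y(m := t, j := w)"
    using xy \<open>m \<noteq> j\<close> by (auto simp: override_on_def fun_eq_iff)
  show "P y"
    by (rule splitsD[OF assms(1), of "x(m := t, j := w)"])
      (use * P \<open>P (y(m := t, j := w))\<close> eq assms(2,3) in auto)
qed

text \<open>The predicate of a quasigroup over an abstract index set, in which no position is
  singled out as the output. \<open>P_cong\<close> lets assignments be total functions that only
  count on \<open>V\<close>.\<close>

locale latin =
  fixes V :: "'i set" and P :: "('i \<Rightarrow> 'a) \<Rightarrow> bool"
  assumes finite_V: "finite V"
    and latin: "i \<in> V \<Longrightarrow> \<exists>!y. P (x(i := y))"
    and P_cong: "(\<And>v. v \<in> V \<Longrightarrow> x v = y v) \<Longrightarrow> P x = P y"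
begin

lemma splits_cong:
  assumes "splits P F A c" "\<And>v. v \<in> V - F \<Longrightarrow> c' v = c v"
  shows "splits P F A c'"
  unfolding splits_def
proof (intro allI impI)
  fix x y
  assume eq: "\<forall>v. v \<notin> F \<longrightarrow> x v = c' v \<and> y v = c' v"
    and P: "P x" "P (override_on x y A)" "P (override_on y x A)"
  define x' where "x' = override_on c x F"
  define y' where "y' = override_on c y F"
  have x': "x' v = x v" and y': "y' v = y v" if "v \<in> V" for v
    using that eq assms(2) by (cases "v \<in> F"; simp add: x'_def y'_def)+
  have "P x' = P x" "P y' = P y" "P (override_on x' y' A) = P (override_on x y A)"
    "P (override_on y' x' A) = P (override_on y x A)"
    by (rule P_cong; simp add: x' y' override_on_def)+
  moreover have "x' v = c v" "y' v = c v" if "v \<notin> F" for v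
    using that by (simp_all add: x'_def y'_def)
  ultimately show "P y"
    using P splitsD[OF assms(1), of x' y'] by simp
qed

text \<open>The hypothesis on \<open>{m, j}\<close> lets \<open>j\<close> be reset to \<open>c j\<close> at the price of a new value at \<open>m\<close>.\<close>

lemma splits_compose:
  assumes mj: "splits P F {m, j} c" "m \<in> F" "j \<in> F" "m \<noteq> j"
    and p: "p \<in> F" "p \<in> V" "p \<noteq> m" "p \<noteq> j" and "m \<in> V"
    and A: "splits P (F - {j}) A c" "A \<subseteq> F - {j}"
  shows "splits P F (if m \<in> A then insert j A else A) c"
proof -
  have "\<exists>t. \<forall>x. (\<forall>v. v \<notin> F \<longrightarrow> x v = c v) \<longrightarrow> x m = s \<longrightarrow> x j = w \<longrightarrow>
      (P x \<longleftrightarrow> P (x(m := t, j := c j)))" for s w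
  proof -
    \<comment> \<open>A single sample \<open>x0\<close> with the prescribed values at
      \<open>m\<close> and \<open>j\<close>, made to satisfy \<open>P\<close> at the spare position
      \<open>p\<close>, determines the \<open>t\<close> that serves all \<open>x\<close>.\<close>
    obtain y0 where "P ((c(m := s, j := w))(p := y0))"
      using latin[OF p(2)] by blast
    moreover define x0 where "x0 = c(m := s, j := w, p := y0)"
    moreover obtain t where "P ((x0(j := c j))(m := t))"
      using latin[OF \<open>m \<in> V\<close>] by blast
    ultimately have x0: "P x0" "P (x0(m := t, j := c j))"
      using \<open>m \<noteq> j\<close> by (simp_all add: fun_upd_twist)
    have "P x \<longleftrightarrow> P (x(m := t, j := c j))" if "\<forall>v. v \<notin> F \<longrightarrow> x v = c v" "x m = s" "x j = w" for x
      by (rule splits_exchange[OF mj, of x0]) (use that x0 p mj x0_def in auto)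
    then show ?thesis by blast
  qed
  then obtain \<tau> where \<tau>: "\<And>x s w. (\<forall>v. v \<notin> F \<longrightarrow> x v = c v) \<Longrightarrow> x m = s \<Longrightarrow> x j = w \<Longrightarrow>
      P x \<longleftrightarrow> P (x(m := \<tau> s w, j := c j))"
    by metis
  define f where "f x = x(m := \<tau> (x m) (x j), j := c j)" for x
  have f: "P x \<longleftrightarrow> P (f x)" if "\<forall>v. v \<notin> F \<longrightarrow> x v = c v" for x
    unfolding f_def by (rule \<tau>[OF that refl refl])
  \<comment> \<open>\<open>j\<close> goes to the side of \<open>m\<close>, since the new value at
    \<open>m\<close> reads \<open>x j\<close>; then \<open>f\<close> carries overriding on
    \<open>A'\<close> to overriding on \<open>A\<close>.\<close>
  define A' where "A' = (if m \<in> A then insert j A else A)"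
  have fo: "f (override_on x y A') = override_on (f x) (f y) A" for x y
    using A(2) \<open>m \<noteq> j\<close> by (auto simp: f_def A'_def override_on_def fun_eq_iff)
  have "splits P F A' c"
    unfolding splits_def
  proof (intro allI impI)
    fix x y
    assume eq: "\<forall>v. v \<notin> F \<longrightarrow> x v = c v \<and> y v = c v"
      and P: "P x" "P (override_on x y A')" "P (override_on y x A')"
    have "\<forall>v. v \<notin> F \<longrightarrow> override_on x y A' v = c v" "\<forall>v. v \<notin> F \<longrightarrow> override_on y x A' v = c v"
      using eq by (simp_all add: override_on_def)
    then have "P (f x)" "P (override_on (f x) (f y) A)" "P (override_on (f y) (f x) A)"
      using P f[of x] f[of "override_on x y A'"] f[of "override_on y x A'"] eq fo by metis+
    moreover have "f x v = c v" "f y v = c v" if "v \<notin> F - {j}" for v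
      using that eq \<open>m \<in> F\<close> by (auto simp: f_def)
    ultimately have "P (f y)"
      using splitsD[OF A(1), of "f x" "f y"] by simp
    then show "P y" using f[of y] eq by simp
  qed
  then show ?thesis by (simp add: A'_def)
qed

end

section \<open>Extending a core without decompositions\<close>

text \<open>What maximality of the retract provides: no nontrivial split of \<open>I\<close> in the
  single context \<open>c0\<close>, but some nontrivial split of every extension by one or two
  positions, in every context \<open>c\<close>.\<close>

locale unsplit_core = latin V P for V :: "'i set" and P :: "('i \<Rightarrow> 'a) \<Rightarrow> bool" +
  fixes I :: "'i set" and c0 :: "'i \<Rightarrow> 'a"
  assumes I_subset: "I \<subseteq> V" and card_I: "4 \<le> card I"
    and unsplit: "A \<subseteq> I \<Longrightarrow> 2 \<le> card A \<Longrightarrow> 2 \<le> card (I - A) \<Longrightarrow> \<not> splits P I A c0"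
    and extension_splits: "I \<subset> F \<Longrightarrow> F \<subseteq> V \<Longrightarrow> card F \<le> card I + 2 \<Longrightarrow>
      \<exists>A\<subseteq>F. 2 \<le> card A \<and> 2 \<le> card (F - A) \<and> splits P F A c"
begin

section \<open>Attaching one further position to \<open>I\<close>\<close>

lemma finite_I: "finite I"
  using I_subset finite_V finite_subset by blast

lemma I_ne: "finite S \<Longrightarrow> card S \<le> 3 \<Longrightarrow> \<exists>p\<in>I. p \<notin> S"
  using card_I card_mono[of S I] by fastforce

text \<open>The property of \<open>c0\<close> in \<open>unsplit\<close>, stated for any context so
  that it can be carried from \<open>c0\<close> to all of them.\<close>

definition rigid :: "('i \<Rightarrow> 'a) \<Rightarrow> bool" where
  "rigid c \<longleftrightarrow> (\<forall>A\<subseteq>I. 2 \<le> card A \<longrightarrow> 2 \<le> card (I - A) \<longrightarrow> \<not> splits P I A c)"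

text \<open>The relation "\<open>j\<close> belongs to \<open>i\<close>": with only \<open>I\<close>
  and \<open>j\<close> free, the values at \<open>i\<close> and \<open>j\<close> enter through one
  common quantity.\<close>

abbreviation link :: "'i \<Rightarrow> 'i \<Rightarrow> ('i \<Rightarrow> 'a) \<Rightarrow> bool" where
  "link i j c \<equiv> splits P (insert j I) {i, j} c"

text \<open>If \<open>j\<close> belonged to both \<open>i\<close> and \<open>i'\<close>, changes at
  \<open>i\<close> could be traded through \<open>j\<close> for changes at \<open>i'\<close>. Then
  \<open>{i, i'}\<close> would split \<open>I\<close>, against rigidity, as
  \<open>card I \<ge> 4\<close> leaves at least two positions on the other side.\<close>

lemma link_unique:
  assumes "rigid c" "j \<in> V - I" "i \<in> I" "i' \<in> I" and L: "link i j c" "link i' j c"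
  shows "i = i'"
proof (rule ccontr)
  assume ne: "i \<noteq> i'"
  have j: "j \<in> V" "j \<notin> I" "j \<noteq> i" "j \<noteq> i'" using assms by auto
  have "splits P I {i, i'} c"
    unfolding splits_def
  proof (intro allI impI)
    fix x y
    assume eq: "\<forall>v. v \<notin> I \<longrightarrow> x v = c v \<and> y v = c v"
      and P: "P x" "P (override_on x y {i, i'})" "P (override_on y x {i, i'})"
    \<comment> \<open>\<open>v\<close> offsets at \<open>j\<close> the change of \<open>x\<close> at
      \<open>i'\<close>; the assignment \<open>w\<close> carrying this \<open>v\<close> is then tied
      to \<open>y\<close> through \<open>i\<close> and to \<open>override_on y x {i, i'}\<close>
      through \<open>i'\<close>.\<close>
    obtain v where v: "P ((x(i' := y i'))(j := v))"
      using latin[OF j(1)] by blast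
    define z where "z = x(i' := y i', j := v)"
    define w where "w = y(i := x i, j := v)"
    have Pz: "P z" using v by (simp add: z_def)
    have z1: "z(i := y i, j := c j) = override_on x y {i, i'}"
      and z2: "z(i' := x i', j := c j) = x"
      and w1: "w(i := y i, j := c j) = y"
      and w2: "w(i' := x i', j := c j) = override_on y x {i, i'}"
      using eq j ne by (auto simp: z_def w_def override_on_def fun_eq_iff)
    have "P w \<longleftrightarrow> P (w(i := y i, j := c j))"
      by (rule splits_exchange[OF L(1), of z])
        (use assms j ne eq Pz z1 P in \<open>auto simp: z_def w_def\<close>)
    moreover have "P w \<longleftrightarrow> P (w(i' := x i', j := c j))"
      by (rule splits_exchange[OF L(2), of z])
        (use assms j ne eq Pz z2 P in \<open>auto simp: z_def w_def\<close>)
    ultimately show "P y" using w1 w2 P by simp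
  qed
  moreover have "card {i, i'} = 2" using ne by simp
  moreover have "card (I - {i, i'}) \<ge> 2"
    using card_I finite_I assms ne by (simp add: card_Diff_subset)
  ultimately show False
    using \<open>rigid c\<close> assms unfolding rigid_def by (metis empty_subsetI insert_subset order_refl)
qed

text \<open>Let \<open>A\<close> be the side containing \<open>j\<close>. Restricting to
  \<open>I\<close> leaves \<open>A - {j}\<close> against at least two positions, so rigidity allows
  only one element \<open>i\<close> in \<open>A - {j}\<close>.\<close>

lemma link_ex:
  assumes "rigid c" "j \<in> V - I"
  shows "\<exists>i\<in>I. link i j c"
proof -
  let ?F = "insert j I"
  have finF: "finite ?F" using finite_I by simp
  obtain A where A: "A \<subseteq> ?F" "2 \<le> card A" "2 \<le> card (?F - A)" "splits P ?F A c" "j \<in> A"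
  proof -
    have "I \<subset> ?F" "?F \<subseteq> V" "card ?F \<le> card I + 2"
      using assms I_subset finite_I by auto
    from extension_splits[OF this, of c]
    obtain B where B: "B \<subseteq> ?F" "2 \<le> card B" "2 \<le> card (?F - B)" "splits P ?F B c" by blast
    show thesis
    proof (cases "j \<in> B")
      case True
      then show thesis using that B by blast
    next
      case False
      moreover have "?F - (?F - B) = B" using B(1) by blast
      ultimately show thesis
        using that[of "?F - B"] B splits_complement[OF B(4,1)] by auto
    qed
  qed
  have finA: "finite A" using A(1) finF finite_subset by blast
  have "splits P I (A \<inter> I) c" by (rule splits_restrict[OF A(4)]) auto
  moreover have "A \<inter> I = A - {j}" "I - (A \<inter> I) = ?F - A" using A assms by auto
  ultimately have "card (A - {j}) < 2"
    using \<open>rigid c\<close> A unfolding rigid_def by (metis inf_le2 not_le)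
  then have "card (A - {j}) = 1" using A finA by simp
  then obtain i where i: "A - {j} = {i}" by (rule card_1_singletonE)
  then have "A = {i, j}" "i \<in> I" using A by auto
  then show ?thesis using A by auto
qed

text \<open>A split of \<open>I\<close> after the change extends along the link of \<open>j\<close>
  to a split with \<open>j\<close> free, and this restricts to a split at the old value of
  \<open>j\<close>.\<close>

lemma rigid_upd:
  assumes "rigid c" "j \<in> V - I"
  shows "rigid (c(j := v))"
  unfolding rigid_def
proof (intro allI impI notI)
  fix A
  assume A: "A \<subseteq> I" "2 \<le> card A" "2 \<le> card (I - A)" "splits P I A (c(j := v))"
  obtain i where i: "i \<in> I" "link i j c" using link_ex[OF assms] by blast
  obtain p where p: "p \<in> I" "p \<notin> {i, j}"
    using I_ne[of "{i, j}"] card_insert_le_m1[of 2 "{j}" i] by auto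
  have F: "insert j I - {j} = I" using assms by auto
  have L: "link i j (c(j := v))" using splits_cong[OF i(2), of "c(j := v)"] by simp
  define A' where "A' = (if i \<in> A then insert j A else A)"
  have "splits P (insert j I) A' (c(j := v))"
    unfolding A'_def by (rule splits_compose[OF L, of p]) (use A assms F i p I_subset in auto)
  then have "splits P I (A' \<inter> I) c" by (rule splits_restrict) auto
  moreover have "A' \<inter> I = A" using A(1) assms by (auto simp: A'_def)
  ultimately show False using \<open>rigid c\<close> A unfolding rigid_def by auto
qed

lemma context_induct:
  assumes "Q c" "S \<subseteq> V - I" "\<And>c j v. j \<in> S \<Longrightarrow> Q c \<Longrightarrow> Q (c(j := v))"
  shows "Q (override_on c d S)"
proof -
  have "finite S" using assms(2) finite_V finite_subset by blast
  have "T \<subseteq> S \<Longrightarrow> Q (override_on c d T)" if "finite T" for T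
    using that assms
  proof (induction T)
    case empty
    then show ?case by (simp add: override_on_def)
  next
    case (insert j T)
    have "override_on c d (insert j T) = (override_on c d T)(j := d j)"
      by (rule override_on_insert)
    then show ?case using insert by simp
  qed
  then show ?thesis using \<open>finite S\<close> by simp
qed

lemma rigid_all: "rigid c"
proof -
  have "rigid c0" using unsplit by (auto simp: rigid_def)
  then have "rigid (override_on c0 c (V - I))"
    by (rule context_induct[of rigid]) (use rigid_upd in blast)+
  moreover have "splits P I A (override_on c0 c (V - I))" if "splits P I A c" for A
    by (rule splits_cong[OF that]) simp
  ultimately show ?thesis unfolding rigid_def by blast
qed

section \<open>Attaching two further positions\<close>

lemma two_step:
  assumes j: "j \<in> V - I" "j' \<in> V - I" "j \<noteq> j'" and i: "i \<in> I"
    and s: "splits P (insert j (insert j' I)) {i, j} c"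
  shows "splits P (insert j (insert j' I)) {i, j, j'} c \<or>
    (\<exists>i'\<in>I. i \<noteq> i' \<and> splits P (insert j (insert j' I)) {i', j'} c)"
proof -
  obtain i' where i': "i' \<in> I" "link i' j' c" using link_ex[OF rigid_all j(2)] by blast
  obtain p where p: "p \<in> I" "p \<notin> {i}" using I_ne[of "{i}"] by auto
  have F: "insert j (insert j' I) - {j} = insert j' I" using j by auto
  \<comment> \<open>The link of \<open>j'\<close> is a split with \<open>j\<close> fixed to
    \<open>c j\<close>; merging \<open>j\<close> into \<open>i\<close> lifts it to free
    \<open>j\<close>, and \<open>j\<close> joins the pair exactly when
    \<open>i = i'\<close>.\<close>
  have "splits P (insert j (insert j' I)) (if i \<in> {i', j'} then insert j {i', j'} else {i', j'}) c"
    by (rule splits_compose[OF s, of p]) (use j F i i' p I_subset in auto)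
  moreover have "i \<noteq> j'" using i j by auto
  ultimately show ?thesis using i' by (cases "i = i'") (auto simp: insert_commute)
qed

text \<open>By rigidity one side of the given split meets \<open>I\<close> in at most one position.
  Going through the few such sides shows that \<open>j\<close> and \<open>j'\<close> either share a
  position of \<open>I\<close> or have one each.\<close>

lemma two_coordinates:
  assumes j: "j \<in> V - I" "j' \<in> V - I" "j \<noteq> j'"
  defines "F \<equiv> insert j (insert j' I)"
  shows "(\<exists>i\<in>I. splits P F {i, j, j'} c) \<or>
    (\<exists>i\<in>I. \<exists>i'\<in>I. i \<noteq> i' \<and> splits P F {i, j} c \<and> splits P F {i', j'} c)"
proof -
  have finF: "finite F" using finite_I by (simp add: F_def)
  have "\<exists>A\<subseteq>F. 2 \<le> card A \<and> card (A \<inter> I) \<le> 1 \<and> splits P F A c"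
  proof -
    have "I \<subset> F" "F \<subseteq> V" "card F \<le> card I + 2"
      using j I_subset finite_I by (auto simp: F_def)
    from extension_splits[OF this, of c]
    obtain B where B: "B \<subseteq> F" "2 \<le> card B" "2 \<le> card (F - B)" "splits P F B c" by blast
    have "splits P I (B \<inter> I) c" by (rule splits_restrict[OF B(4)]) (auto simp: F_def)
    then have "\<not> (2 \<le> card (B \<inter> I) \<and> 2 \<le> card (I - B \<inter> I))"
      using rigid_all[of c] unfolding rigid_def by blast
    moreover have "I - B \<inter> I = (F - B) \<inter> I" by (auto simp: F_def)
    ultimately show ?thesis
      using B splits_complement[OF B(4,1)] Diff_subset[of F B]
      by (cases "card (B \<inter> I) \<le> 1") (fastforce simp del: Diff_subset)+
  qed
  then obtain A where A: "A \<subseteq> F" "2 \<le> card A" "card (A \<inter> I) \<le> 1" "splits P F A c" by blast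
  have finA: "finite A" using A(1) finF finite_subset by blast
  have split_A: "A = (A \<inter> I) \<union> (A \<inter> {j, j'})" using A(1) by (auto simp: F_def)
  show ?thesis
  proof (cases "A \<inter> I = {}")
    case True
    then have "A \<subseteq> {j, j'}" using split_A by auto
    then have Aeq: "A = {j', j}"
      using A(2) j(3) card_seteq[of "{j, j'}" A] by auto
    obtain i where i: "i \<in> I" "link i j' c" using link_ex[OF rigid_all j(2)] by blast
    obtain p where p: "p \<in> I" using i by blast
    have F': "F - {j} = insert j' I" using j by (auto simp: F_def)
    \<comment> \<open>With \<open>A = {j', j}\<close> the position \<open>j\<close> is absorbed by
      \<open>j'\<close> rather than by a position of \<open>I\<close>, so the link of
      \<open>j'\<close> grows to \<open>{i, j', j}\<close>.\<close>
    have "splits P F (if j' \<in> {i, j'} then insert j {i, j'} else {i, j'}) c"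
      by (rule splits_compose[OF A(4)[unfolded Aeq], of p])
        (use j i p I_subset F' in \<open>auto simp: F_def\<close>)
    then show ?thesis using i by (auto simp: insert_commute)
  next
    case False
    then have "card (A \<inter> I) = 1" using A(3) finA
      by (metis One_nat_def card_0_eq finite_Int le_SucE le_zero_eq)
    then obtain i where i: "A \<inter> I = {i}" by (rule card_1_singletonE)
    then have iI: "i \<in> I" by blast
    consider "A = {i, j, j'}" | "A = {i, j}" | "A = {i, j'}" | "A = {i}"
      using split_A i by (cases "j \<in> A"; cases "j' \<in> A") auto
    then show ?thesis
    proof cases
      case 1
      then show ?thesis using A iI by blast
    next
      case 2
      from two_step[OF j iI, of c, folded F_def] show ?thesis
        using A(4) iI unfolding 2 by blast
    next
      case 3
      have comm: "insert j' (insert j I) = F" "{i, j', j} = {i, j, j'}" by (auto simp: F_def)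
      from two_step[OF j(2,1) j(3)[symmetric] iI, unfolded comm, of c] show ?thesis
        using A(4) iI unfolding 3 by metis
    next
      case 4
      then show ?thesis using A by simp
    qed
  qed
qed

text \<open>A split with both \<open>j\<close> and \<open>j'\<close> free restricts to a link of
  \<open>j\<close> with one and the same position at every value of \<open>j'\<close>; by uniqueness
  this position is \<open>i\<close>.\<close>

lemma link_upd:
  assumes L: "link i j c" and i: "i \<in> I" and j: "j \<in> V - I" "j' \<in> V - I"
  shows "link i j (c(j' := v))"
proof (cases "j = j'")
  case True
  then show ?thesis using splits_cong[OF L, of "c(j' := v)"] by simp
next
  case False
  let ?F = "insert j (insert j' I)"
  \<comment> \<open>Both alternatives, \<open>{i0, j, j'}\<close> and \<open>{i0, j}\<close>, leave
    \<open>{i0, j}\<close> once \<open>j'\<close> is fixed.\<close>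
  obtain i0 A where A: "i0 \<in> I" "splits P ?F A c" "A \<inter> insert j I = {i0, j}"
    using two_coordinates[OF j False, of c] j False
    by (elim disjE bexE conjE) (auto simp: Int_insert_left)
  have "splits P (insert j I) (A \<inter> insert j I) c"
    "splits P (insert j I) (A \<inter> insert j I) (c(j' := v))"
    by (rule splits_restrict[OF A(2)]; auto)+
  then show ?thesis
    using A link_unique[OF rigid_all j(1) i A(1) L] by simp
qed

lemma link_all:
  assumes L: "link i j c" and i: "i \<in> I" and j: "j \<in> V - I"
  shows "link i j d"
proof -
  have "link i j (override_on c d (V - I))"
    by (rule context_induct[of "link i j", OF L]) (use i j link_upd in auto)
  then show ?thesis by (rule splits_cong) auto
qed

section \<open>Partition of the positions into blocks\<close>

definition host :: "'i \<Rightarrow> 'i" where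
  "host j = (if j \<in> I then j else (SOME i. i \<in> I \<and> link i j c0))"

text \<open>The choice is made in the context \<open>c0\<close>; \<open>link_all\<close> makes it
  valid in every other.\<close>

lemma host:
  assumes "j \<in> V - I"
  shows "host j \<in> I" "link (host j) j c"
proof -
  have "host j \<in> I \<and> link (host j) j c0"
    using assms link_ex[OF rigid_all assms, of c0] someI_ex[of "\<lambda>i. i \<in> I \<and> link i j c0"]
    by (auto simp: host_def)
  then show "host j \<in> I" "link (host j) j c"
    using link_all assms by blast+
qed

lemma host_I: "i \<in> I \<Longrightarrow> host i = i"
  by (simp add: host_def)

definition block :: "'i \<Rightarrow> 'i set" where
  "block i = {v \<in> V. host v = i}"

lemma block_I: "i \<in> I \<Longrightarrow> block i \<inter> I = {i}"
  using I_subset by (auto simp: block_def host_I)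

text \<open>Were \<open>{i, j, j'}\<close> split off for one \<open>i\<close>, restriction would
  make \<open>i\<close> the host of both. The result makes the exchange at \<open>host j\<close> and
  \<open>j\<close> insensitive to the value at \<open>j'\<close>.\<close>

lemma two_hosts:
  assumes j: "j \<in> V - I" "j' \<in> V - I" and ne: "host j \<noteq> host j'"
  shows "splits P (insert j (insert j' I)) {host j, j} c"
proof -
  have jj: "j \<noteq> j'" using ne by auto
  let ?F = "insert j (insert j' I)"
  have unique: "i = host k" if "splits P ?F A c" "A \<inter> insert k I = {i, k}" "i \<in> I" "k \<in> {j, j'}" for i k A
  proof -
    have "splits P (insert k I) (A \<inter> insert k I) c"
      by (rule splits_restrict[OF that(1)]) (use that in auto)
    moreover have k: "k \<in> V - I" using that j by auto
    ultimately show ?thesis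
      using link_unique[OF rigid_all k that(3) host(1)[OF k], of c] host(2)[OF k] that by simp
  qed
  from two_coordinates[OF j jj, of c] show ?thesis
  proof (elim disjE bexE conjE)
    fix i assume i: "i \<in> I" "splits P ?F {i, j, j'} c"
    have "i = host j" "i = host j'"
      by (rule unique[OF i(2) _ i(1)]; use i j jj in auto)+
    then show ?thesis using ne by simp
  next
    fix i i' assume i: "i \<in> I" "splits P ?F {i, j} c"
    have "i = host j" by (rule unique[OF i(2) _ i(1)]; use i j jj in auto)
    then show ?thesis using i by simp
  qed
qed

text \<open>The exchange at \<open>(host j, j)\<close> is carried from \<open>x\<close> to \<open>y\<close> through assignments that change one
  fixed coordinate at a time; each of them is repaired to satisfy \<open>P\<close> at some position in \<open>I\<close>.\<close>

lemma exchange_imp: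
  assumes j: "j \<in> V - I"
    and xy: "\<And>v. v \<in> block (host j) \<Longrightarrow> x v = y v"
    and P: "P x" "P (x(host j := t, j := w))" "P y"
  shows "P (y(host j := t, j := w))"
proof -
  define i where "i = host j"
  have i: "i \<in> I" using host(1)[OF j] by (simp add: i_def)
  have ij: "i \<noteq> j" using i j by auto
  \<comment> \<open>\<open>S\<close> contains the positions off \<open>I\<close> at which
    \<open>x\<close> and \<open>y\<close> may still differ. On \<open>I\<close>, agreement is
    required at \<open>i\<close> only.\<close>
  have main: "P (y(i := t, j := w))"
    if "finite S" "S \<subseteq> V - I - block i" "\<forall>v\<in>V - I - S. x v = y v" "x i = y i"
      "P x" "P (x(i := t, j := w))" for S x
    using that
  proof (induction S arbitrary: x)
    case empty
    \<comment> \<open>\<open>x'\<close> is \<open>x\<close> corrected off \<open>V\<close> so that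
      it lies in the context of \<open>y\<close>, where the link of \<open>j\<close>
      applies.\<close>
    define x' where "x' = override_on y x I"
    have x': "x' v = x v" if "v \<in> V" for v
      using that empty by (auto simp: x'_def override_on_def)
    have "P x' = P x" "P (x'(i := t, j := w)) = P (x(i := t, j := w))"
      by (rule P_cong; simp add: x')+
    then have "P x'" "P (x'(i := t, j := w))" using empty by simp_all
    then have "P y \<longleftrightarrow> P (y(i := t, j := w))"
      by (intro splits_exchange[of P "insert j I" i j y x'])
        (use host(2)[OF j, of y] i ij j empty x' I_subset in \<open>auto simp: i_def[symmetric] x'_def\<close>)
    then show ?case using P(3) by blast
  next
    case (insert j' S)
    have j': "j' \<in> V - I" "host j' \<noteq> i" "j' \<noteq> j" "j' \<noteq> i"
      using insert.prems i by (auto simp: block_def i_def)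
    \<comment> \<open>The repair takes place at some \<open>p \<noteq> i\<close>, so that the
      agreement at \<open>i\<close> is kept.\<close>
    obtain p where p: "p \<in> I" "p \<noteq> i" using I_ne[of "{i}"] by auto
    then have p': "p \<in> V" "p \<noteq> j" "p \<noteq> j'" using I_subset j j' by auto
    obtain s where s: "P ((x(j' := y j'))(p := s))" using latin[OF p'(1)] by blast
    define z where "z = x(j' := y j', p := s)"
    have "splits P (insert j (insert j' I)) {i, j} x"
      using two_hosts[OF j j'(1)] j' by (simp add: i_def)
    then have "P z \<longleftrightarrow> P (z(i := t, j := w))"
      by (rule splits_exchange[of _ _ _ _ x x, OF _ _ _ ij _ _ _ _ insert.prems(4,5)])
        (use i ij j j' p p' in \<open>auto simp: z_def\<close>)
    then have "P z" "P (z(i := t, j := w))" using s by (simp_all add: z_def)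
    moreover have "\<forall>v\<in>V - I - S. z v = y v" "z i = y i" "S \<subseteq> V - I - block i"
      using insert.prems p p' j' by (auto simp: z_def)
    ultimately show ?case by (intro insert.IH[of z])
  qed
  have "i \<in> block i" using i block_I by blast
  then have "P (y(i := t, j := w))"
    by (intro main[of "V - I - block i" x]) (use xy P finite_V in \<open>auto simp: i_def\<close>)
  then show ?thesis by (simp add: i_def)
qed

section \<open>Operations attached to the blocks\<close>

lemma exchange_ex:
  assumes j: "j \<in> V - I"
  shows "\<exists>t. \<forall>x. (\<forall>v\<in>block (host j). x v = a v) \<longrightarrow> (P x \<longleftrightarrow> P (x(host j := t, j := w)))"
proof -
  define i where "i = host j"
  have i: "i \<in> I" using host(1)[OF j] by (simp add: i_def)
  then have iV: "i \<in> V" and ij: "i \<noteq> j" using j I_subset by auto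
  \<comment> \<open>\<open>p\<close> lies outside the block, so making \<open>P\<close> true there
    keeps the block values of \<open>a\<close>. The \<open>t\<close> found at this sample
    \<open>x0\<close> serves every \<open>x\<close> with these block values by
    \<open>exchange_imp\<close>.\<close>
  obtain p where p: "p \<in> I" "p \<noteq> i" using I_ne[of "{i}"] by auto
  then have p': "p \<in> V" "p \<notin> block i" using I_subset block_I i by blast+
  obtain s where s: "P (a(p := s))" using latin[OF p'(1)] by blast
  define x0 where "x0 = a(p := s)"
  obtain t where t: "P ((x0(j := w))(i := t))" using latin[OF iV] by blast
  have x0: "P x0" "P (x0(i := t, j := w))" "\<forall>v\<in>block i. x0 v = a v"
    using s t ij p' by (auto simp: x0_def fun_upd_twist)
  have jb: "j \<in> block i" using j by (auto simp: block_def i_def)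
  have ib: "i \<in> block i" using block_I i by blast
  have "P x \<longleftrightarrow> P (x(i := t, j := w))" if x: "\<forall>v\<in>block i. x v = a v" for x
  proof
    assume "P x"
    then show "P (x(i := t, j := w))"
      using exchange_imp[OF j, of x0 x t w] x x0 by (simp add: i_def[symmetric])
  next
    assume *: "P (x(i := t, j := w))"
    \<comment> \<open>The converse is the same exchange with the pairs swapped:
      \<open>(t, w)\<close> goes back to \<open>(a i, a j)\<close>.\<close>
    have "(x0(i := t, j := w))(i := a i, j := a j) = x0" "(x(i := t, j := w))(i := a i, j := a j) = x"
      using ib jb x x0(3) ij by (auto simp: fun_eq_iff)
    then show "P x"
      using exchange_imp[OF j, of "x0(i := t, j := w)" "x(i := t, j := w)" "a i" "a j"] x x0 *
      by (simp add: i_def[symmetric])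
  qed
  then show ?thesis by (auto simp: i_def)
qed

text \<open>The other positions of the block are reset to \<open>c\<close> one at a time, each paid
  for by a new value at \<open>i\<close>. That value depends only on the block values of
  \<open>a\<close>, hence one \<open>t\<close> fits all \<open>x\<close>.\<close>

lemma block_reset_ex:
  assumes i: "i \<in> I"
  shows "\<exists>t. \<forall>x. (\<forall>v\<in>block i. x v = a v) \<longrightarrow>
    (P x \<longleftrightarrow> P (override_on x (c(i := t)) (block i)))"
proof -
  have "\<exists>t. \<forall>x. (\<forall>v\<in>block i. x v = a v) \<longrightarrow> (P x \<longleftrightarrow> P ((override_on x c S)(i := t)))"
    if "finite S" "S \<subseteq> block i - {i}" for S
    using that
  proof (induction S)
    case empty
    have "i \<in> block i" using block_I i by blast
    then have "\<forall>x. (\<forall>v\<in>block i. x v = a v) \<longrightarrow> (P x \<longleftrightarrow> P ((override_on x c {})(i := a i)))"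
      by (metis fun_upd_triv override_on_emptyset)
    then show ?case by blast
  next
    case (insert j S)
    then obtain t where t: "\<And>x. \<forall>v\<in>block i. x v = a v \<Longrightarrow> P x \<longleftrightarrow> P ((override_on x c S)(i := t))"
      by blast
    have jb: "j \<in> block i" "j \<noteq> i" using insert.prems by auto
    then have j: "j \<in> V - I" "host j = i" using block_I[OF i] by (auto simp: block_def)
    obtain u where u: "\<And>x. \<forall>v\<in>block i. x v = ((override_on a c S)(i := t)) v \<Longrightarrow>
        P x \<longleftrightarrow> P (x(i := u, j := c j))"
      using exchange_ex[OF j(1), of "(override_on a c S)(i := t)" "c j"] j(2) by auto
    have "P x \<longleftrightarrow> P ((override_on x c (insert j S))(i := u))" if x: "\<forall>v\<in>block i. x v = a v" for x
    proof -
      have "P x \<longleftrightarrow> P ((override_on x c S)(i := t))" using t x by blast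
      also have "\<dots> \<longleftrightarrow> P (((override_on x c S)(i := t))(i := u, j := c j))"
        by (rule u) (use x in \<open>auto simp: override_on_def\<close>)
      also have "((override_on x c S)(i := t))(i := u, j := c j) = (override_on x c (insert j S))(i := u)"
        using jb by (auto simp: override_on_def fun_eq_iff)
      finally show ?thesis .
    qed
    then show ?case by blast
  qed
  note reset = this
  have fin: "finite (block i - {i})" using finite_V by (simp add: block_def)
  have "(override_on x c (block i - {i}))(i := t) = override_on x (c(i := t)) (block i)" for x t
    using block_I[OF i] by (auto simp: override_on_def fun_eq_iff)
  then show ?thesis using reset[OF fin order_refl] by (simp only:)
qed

text \<open>The operation \<open>q\<^sup>i\<close> of the decomposition: the value at
  \<open>i\<close> that makes up for resetting the rest of its block to \<open>c\<close>. Its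
  argument is a whole assignment, read on the block only.\<close>

definition block_op :: "('i \<Rightarrow> 'a) \<Rightarrow> 'i \<Rightarrow> ('i \<Rightarrow> 'a) \<Rightarrow> 'a" where
  "block_op c i a = (SOME t. \<forall>x. (\<forall>v\<in>block i. x v = a v) \<longrightarrow>
    (P x \<longleftrightarrow> P (override_on x (c(i := t)) (block i))))"

lemma block_op:
  assumes "i \<in> I" "\<And>v. v \<in> block i \<Longrightarrow> x v = a v"
  shows "P x \<longleftrightarrow> P (override_on x (c(i := block_op c i a)) (block i))"
proof -
  have "\<forall>x. (\<forall>v\<in>block i. x v = a v) \<longrightarrow>
      (P x \<longleftrightarrow> P (override_on x (c(i := block_op c i a)) (block i)))"
    unfolding block_op_def by (rule someI_ex[OF block_reset_ex[OF assms(1)]])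
  then show ?thesis using assms(2) by blast
qed

text \<open>In the frame \<open>e\<close>, only the value \<open>t\<close> at \<open>i\<close>
  satisfies \<open>P\<close>. Hence \<open>block_op\<close> takes the value \<open>t\<close> iff
  \<open>P\<close> holds for \<open>e\<close> with the block values inserted, and unique solvability
  of \<open>P\<close> carries over.\<close>

lemma block_op_latin:
  assumes i: "i \<in> I" and v: "v \<in> block i"
  shows "\<exists>!y. block_op c i (a(v := y)) = t"
proof -
  obtain p where p: "p \<in> I" "p \<noteq> i" using I_ne[of "{i}"] by auto
  then have p': "p \<in> V" "p \<notin> block i" using I_subset block_I i by blast+
  have iV: "i \<in> V" "i \<in> block i" using i I_subset block_I by auto
  obtain s where s: "P ((c(i := t))(p := s))" using latin[OF p'(1)] by blast
  define e where "e = c(p := s)"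
  have e: "P (e(i := u)) \<longleftrightarrow> u = t" for u
    using s p latin[OF iV(1), of e] by (auto simp: e_def fun_upd_twist)
  have "block_op c i b = t \<longleftrightarrow> P (override_on e b (block i))" for b
  proof -
    have "P (override_on e b (block i)) \<longleftrightarrow>
        P (override_on (override_on e b (block i)) (c(i := block_op c i b)) (block i))"
      by (rule block_op[OF i]) simp
    also have "override_on (override_on e b (block i)) (c(i := block_op c i b)) (block i) =
        e(i := block_op c i b)"
      using iV p' by (auto simp: override_on_def fun_eq_iff e_def)
    finally show ?thesis unfolding e by blast
  qed
  moreover have "override_on e (a(v := y)) (block i) = (override_on e a (block i))(v := y)" for y
    using v by (auto simp: override_on_def fun_eq_iff)
  ultimately show ?thesis
    using latin[of v "override_on e a (block i)"] v by (simp add: block_def)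
qed

lemma block_op_cong:
  assumes "\<And>v. v \<in> block i \<Longrightarrow> a v = b v"
  shows "block_op c i a = block_op c i b"
  using assms by (simp add: block_op_def cong: ball_cong)

text \<open>The blocks are reset one after another. Resetting other blocks leaves the block of
  \<open>i\<close> untouched, so \<open>block_op\<close> still reads the values of \<open>x\<close>
  there.\<close>

lemma decomposition: "P x \<longleftrightarrow> P (\<lambda>v. if v \<in> I then block_op c v x else c v)"
proof -
  define f where "f T v = (if host v \<in> T then if v \<in> I then block_op c v x else c v else x v)" for T v
  have "P x \<longleftrightarrow> P (f T)" if "finite T" "T \<subseteq> I" for T
    using that
  proof (induction T)
    case empty
    then show ?case by (simp add: f_def)
  next
    case (insert i T)
    have i: "i \<in> I" using insert by auto
    have "P (f T) \<longleftrightarrow> P (override_on (f T) (c(i := block_op c i x)) (block i))"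
      by (rule block_op[OF i]) (use insert in \<open>auto simp: f_def block_def\<close>)
    also have "\<dots> \<longleftrightarrow> P (f (insert i T))"
      by (rule P_cong) (use insert host_I i in \<open>auto simp: override_on_def f_def block_def\<close>)
    finally show ?case using insert by simp
  qed
  then have "P x \<longleftrightarrow> P (f I)" using finite_I by simp
  also have "\<dots> \<longleftrightarrow> P (\<lambda>v. if v \<in> I then block_op c v x else c v)"
  proof (rule P_cong)
    fix v assume "v \<in> V"
    then have "host v \<in> I" using host(1)[of v] host_I[of v] by (cases "v \<in> I") auto
    then show "f I v = (if v \<in> I then block_op c v x else c v)" by (simp add: f_def)
  qed
  finally show ?thesis .
qed

end

section \<open>Quasigroups on lists\<close>

lemma quasigroupD:
  "quasigroup m q \<Longrightarrow> length xs = Suc m \<Longrightarrow> i < Suc m \<Longrightarrow> \<exists>!y. qpred q (xs[i := y])"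
  unfolding quasigroup_def by blast

text \<open>Solving for the last position defines the operation; solvability in all positions makes
  it a quasigroup.\<close>

lemma quasigroup_of_predicate:
  assumes R: "\<And>xs i. length xs = Suc m \<Longrightarrow> i < Suc m \<Longrightarrow> \<exists>!y. R (xs[i := y])"
  obtains q where "quasigroup m q" "\<And>xs. length xs = Suc m \<Longrightarrow> qpred q xs \<longleftrightarrow> R xs"
proof
  define q where "q vs = (THE y. R (vs @ [y]))" for vs
  show q: "qpred q xs \<longleftrightarrow> R xs" if "length xs = Suc m" for xs
  proof -
    obtain vs z where xs: "xs = vs @ [z]" "length vs = m"
      using \<open>length xs = Suc m\<close> by (auto simp: length_Suc_conv_rev)
    have ex1: "\<exists>!y. R (vs @ [y])"
      using R[of xs m] xs by (simp add: list_update_append)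
    then have "q vs = z \<longleftrightarrow> R (vs @ [z])"
      unfolding q_def by (metis (mono_tags, lifting) theI')
    then show ?thesis by (simp add: qpred_def xs)
  qed
  then show "quasigroup m q" unfolding quasigroup_def using R by simp
qed

section \<open>Passage between value lists and assignments\<close>

definition assign :: "('i \<Rightarrow> 'a) \<Rightarrow> 'i list \<Rightarrow> 'a list \<Rightarrow> 'i \<Rightarrow> 'a" where
  "assign c vs ys v = (case map_of (zip vs ys) v of None \<Rightarrow> c v | Some y \<Rightarrow> y)"

lemma assign_nth:
  "distinct vs \<Longrightarrow> length ys = length vs \<Longrightarrow> i < length vs \<Longrightarrow> assign c vs ys (vs ! i) = ys ! i"
  by (simp add: assign_def map_of_zip_nth)

lemma assign_other: "v \<notin> set vs \<Longrightarrow> assign c vs ys v = c v"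
  by (auto simp: assign_def split: option.split dest!: map_of_SomeD set_zip_leftD)

lemma map_assign: "distinct vs \<Longrightarrow> length ys = length vs \<Longrightarrow> map (assign c vs ys) vs = ys"
  by (auto intro: nth_equalityI simp: assign_nth)

lemma assign_map: "assign c vs (map x vs) = override_on c x (set vs)"
  by (induction vs) (auto simp: assign_def override_on_def fun_eq_iff)

lemma assign_update:
  assumes "distinct vs" "length ys = length vs" "i < length vs"
  shows "assign c vs (ys[i := y]) = (assign c vs ys)(vs ! i := y)"
proof
  fix v
  show "assign c vs (ys[i := y]) v = ((assign c vs ys)(vs ! i := y)) v"
  proof (cases "v \<in> set vs")
    case True
    then obtain k where "k < length vs" "v = vs ! k" by (auto simp: in_set_conv_nth)
    then show ?thesis using assms by (auto simp: assign_nth nth_eq_iff_index_eq)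
  next
    case False
    then show ?thesis using assms by (auto simp: assign_other)
  qed
qed

lemma map_fun_upd_nth:
  "distinct vs \<Longrightarrow> i < length vs \<Longrightarrow> map (x(vs ! i := y)) vs = (map x vs)[i := y]"
  by (auto intro!: nth_equalityI simp: nth_list_update nth_eq_iff_index_eq)

lemma set_nths_upt: "S \<subseteq> {..<n} \<Longrightarrow> set (nths [0..<n] S) = S"
  by (force simp: set_nths)

lemma length_nths_upt: "S \<subseteq> {..<n} \<Longrightarrow> length (nths [0..<n] S) = card S"
  by (metis distinct_card distinct_nthsI distinct_upt set_nths_upt)

lemma quasigroup_latin:
  assumes "quasigroup m Q" "distinct fs" "length fs = Suc m"
  shows "latin (set fs) (\<lambda>x. qpred Q (map x fs))"
proof
  fix i x assume "i \<in> set fs"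
  then obtain k where k: "k < length fs" "i = fs ! k" by (auto simp: in_set_conv_nth)
  show "\<exists>!y. qpred Q (map (x(i := y)) fs)"
    unfolding k(2) map_fun_upd_nth[OF assms(2) k(1)]
    by (rule quasigroupD[OF assms(1)]) (use k assms in auto)
next
  fix x y :: "'b \<Rightarrow> 'a" assume "\<And>v. v \<in> set fs \<Longrightarrow> x v = y v"
  then have "map x fs = map y fs" by simp
  then show "qpred Q (map x fs) = qpred Q (map y fs)" by (rule arg_cong)
qed simp

text \<open>Freezing the positions off \<open>ws\<close> as in \<open>c\<close> keeps unique
  solvability on \<open>ws\<close>. The last entry of \<open>ws\<close> becomes the output.\<close>

lemma (in latin) quasigroup_assign:
  assumes ws: "distinct ws" "set ws \<subseteq> V" "length ws = Suc m"
  obtains q where "quasigroup m q"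
    "\<And>xs. length xs = Suc m \<Longrightarrow> qpred q xs \<longleftrightarrow> P (assign c ws xs)"
proof (rule quasigroup_of_predicate[of m "\<lambda>xs. P (assign c ws xs)"])
  fix xs :: "'a list" and i
  assume "length xs = Suc m" "i < Suc m"
  then have "assign c ws (xs[i := y]) = (assign c ws xs)(ws ! i := y)" and "ws ! i \<in> V" for y
    using ws by (auto intro: assign_update)
  then show "\<exists>!y. P (assign c ws (xs[i := y]))" using latin by simp
qed (rule that)

section \<open>Reducibility in terms of splits\<close>

lemma splits_eq:
  assumes "splits P F A c" "\<And>x. (\<And>v. v \<notin> F \<Longrightarrow> x v = c v) \<Longrightarrow> P' x \<longleftrightarrow> P x"
  shows "splits P' F A c"
  unfolding splits_def
proof (intro allI impI)
  fix x y
  assume eq: "\<forall>v. v \<notin> F \<longrightarrow> x v = c v \<and> y v = c v"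
    and P: "P' x" "P' (override_on x y A)" "P' (override_on y x A)"
  have "P' x = P x" "P' y = P y" "P' (override_on x y A) = P (override_on x y A)"
    "P' (override_on y x A) = P (override_on y x A)"
    by (rule assms(2); use eq in \<open>simp add: override_on_def\<close>)+
  then show "P' y" using splitsD[OF assms(1), of x y] P eq by blast
qed

text \<open>\<open>A\<close> consists of the positions read by the inner operation \<open>q\<close>.
  If \<open>x\<close> satisfies the predicate both as it is and with \<open>y\<close> inserted on
  \<open>A\<close>, unique solvability of \<open>K\<close> in its first argument forces equal values
  of \<open>q\<close>, so \<open>x\<close> and \<open>y\<close> are interchangeable on
  \<open>A\<close>.\<close>

lemma reducible_splits:
  assumes red: "reducible m Q" and fs: "distinct fs" "length fs = Suc m"
  shows "\<exists>A\<subseteq>set fs. 2 \<le> card A \<and> 2 \<le> card (set fs - A) \<and>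
    splits (\<lambda>x. qpred Q (map x fs)) (set fs) A c"
proof -
  obtain \<eta> j q K where \<eta>: "\<eta> permutes {..<Suc m}" and j: "2 \<le> j" "j + 2 \<le> Suc m"
    and K: "quasigroup (Suc m - j) K"
    and Q: "\<And>xs. length xs = Suc m \<Longrightarrow> qpred Q xs \<longleftrightarrow>
      qpred K (q (map (\<lambda>i. xs ! \<eta> i) [0..<j]) # map (\<lambda>i. xs ! \<eta> i) [j..<Suc m])"
    using red unfolding reducible_def by blast
  define g where "g i = fs ! \<eta> i" for i
  have \<eta>_less: "\<eta> i < Suc m" if "i < Suc m" for i
    using permutes_in_image[OF \<eta>] that by (metis lessThan_iff)
  have g_bij: "bij_betw g {..<Suc m} (set fs)"
  proof -
    have "bij_betw ((!) fs) {..<Suc m} (set fs)" using bij_betw_nth fs by metis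
    then have "bij_betw ((!) fs \<circ> \<eta>) {..<Suc m} (set fs)"
      using bij_betw_trans permutes_imp_bij[OF \<eta>] by blast
    then show ?thesis by (simp add: g_def[abs_def] comp_def)
  qed
  define A where "A = g ` {..<j}"
  have inj: "inj_on g {..<Suc m}" and im: "g ` {..<Suc m} = set fs"
    using g_bij by (auto simp: bij_betw_def)
  have subs: "{..<j} \<subseteq> {..<Suc m}" "{j..<Suc m} \<subseteq> {..<Suc m}" using j by auto
  have A: "A \<subseteq> set fs" using im subs by (auto simp: A_def)
  have "{..<Suc m} - {..<j} = {j..<Suc m}" by auto
  then have compl: "set fs - A = g ` {j..<Suc m}"
    using inj_on_image_set_diff[OF inj, of "{..<Suc m}" "{..<j}"] subs im by (simp add: A_def)
  have "card A = j" "card (set fs - A) = Suc m - j"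
    unfolding compl unfolding A_def using inj_on_subset[OF inj subs(1)] inj_on_subset[OF inj subs(2)]
    by (simp_all add: card_image)
  moreover
  have P: "qpred Q (map x fs) \<longleftrightarrow> qpred K (q (map (\<lambda>i. x (g i)) [0..<j]) # map (\<lambda>i. x (g i)) [j..<Suc m])" for x
  proof -
    have *: "map (\<lambda>i. map x fs ! \<eta> i) [a..<b] = map (\<lambda>i. x (g i)) [a..<b]" if "b \<le> Suc m" for a b
      using fs \<eta>_less that by (auto simp: g_def)
    have "j \<le> Suc m" using j by simp
    then show ?thesis using Q[of "map x fs"] fs *[of j 0] *[of "Suc m" j] by (simp del: upt_Suc)
  qed
  have "splits (\<lambda>x. qpred Q (map x fs)) (set fs) A c"
    unfolding splits_def
  proof (intro allI impI)
    fix x y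
    assume eq: "\<forall>v. v \<notin> set fs \<longrightarrow> x v = c v \<and> y v = c v"
      and prems: "qpred Q (map x fs)" "qpred Q (map (override_on x y A) fs)"
        "qpred Q (map (override_on y x A) fs)"
    have gA: "g i \<in> A \<longleftrightarrow> i < j" if "i < Suc m" for i
      using that subs inj_on_image_mem_iff[OF inj, of i "{..<j}"] by (auto simp: A_def)
    have left: "map (\<lambda>i. override_on u w A (g i)) [0..<j] = map (\<lambda>i. w (g i)) [0..<j]"
      and right: "map (\<lambda>i. override_on u w A (g i)) [j..<Suc m] = map (\<lambda>i. u (g i)) [j..<Suc m]" for u w
      using gA j by (auto simp: override_on_def)
    let ?ex = "q (map (\<lambda>i. x (g i)) [0..<j])" and ?ey = "q (map (\<lambda>i. y (g i)) [0..<j])"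
    let ?rx = "map (\<lambda>i. x (g i)) [j..<Suc m]" and ?ry = "map (\<lambda>i. y (g i)) [j..<Suc m]"
    have "qpred K (?ex # ?rx)" "qpred K (?ey # ?rx)" and last: "qpred K (?ex # ?ry)"
      using prems unfolding P left right by blast+
    moreover have "\<exists>!e. qpred K ((?ex # ?rx)[0 := e])"
      by (rule quasigroupD[OF K]) (use j in auto)
    ultimately have "?ex = ?ey" by (metis list_update_code(2))
    then show "qpred Q (map y fs)" using last unfolding P by metis
  qed
  ultimately show ?thesis using A j by (intro exI[of _ A]) auto
qed

text \<open>Two reference positions, \<open>a\<close> in \<open>A\<close> and \<open>b\<close> off
  \<open>A\<close>, yield the factors: \<open>q\<close> reads \<open>A\<close> and solves for
  \<open>b\<close> with the remaining positions fixed, while in \<open>K\<close> the position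
  \<open>a\<close> alone stands for the whole side \<open>A\<close>.\<close>

lemma splits_reducible:
  assumes Q: "quasigroup m Q" and fs: "distinct fs" "length fs = Suc m"
    and A: "A \<subseteq> set fs" "2 \<le> card A" "2 \<le> card (set fs - A)"
    and S: "splits (\<lambda>x. qpred Q (map x fs)) (set fs) A c"
  shows "reducible m Q"
proof -
  define P where "P x = qpred Q (map x fs)" for x
  interpret latin "set fs" P
    using quasigroup_latin[OF Q fs] by (simp add: P_def[abs_def])
  have S: "splits P (set fs) A c" using S by (simp add: P_def[abs_def])
  define as where "as = filter (\<lambda>v. v \<in> A) fs"
  define bs where "bs = filter (\<lambda>v. v \<notin> A) fs"
  define j where "j = length as"
  have ab: "distinct as" "distinct bs" "set as = A" "set bs = set fs - A"
    using fs A by (auto simp: as_def bs_def)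
  have j: "2 \<le> j" "j + length bs = Suc m"
    using A(2) ab distinct_card[of as] sum_length_filter_compl[of "\<lambda>v. v \<in> A" fs] fs
    by (auto simp: j_def as_def bs_def)
  have lb: "2 \<le> length bs" using A(3) ab distinct_card[of bs] by simp
  have "mset (as @ bs) = mset fs" by (simp add: as_def bs_def)
  then obtain \<eta> where \<eta>: "\<eta> permutes {..<Suc m}" "permute_list \<eta> fs = as @ bs"
    using mset_eq_permutation[of "as @ bs" fs] fs by auto
  have "as \<noteq> []" "bs \<noteq> []" using j lb by (auto simp: j_def)
  then obtain a b where a: "a \<in> A" and b: "b \<in> set fs" "b \<notin> A"
    using ab by (metis DiffE list.set_sel(1))
  then have aF: "a \<in> set fs" "a \<noteq> b" using A by auto
  \<comment> \<open>\<open>\<sigma>\<close> recodes a value of \<open>q\<close>, found at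
    \<open>b\<close>, as the value at \<open>a\<close> that goes with it while all other positions
    are as in \<open>c\<close>. It is a bijection, which makes \<open>K\<close> uniquely solvable in
    its first argument.\<close>
  define \<sigma> where "\<sigma> y = (THE s. P (c(b := y, a := s)))" for y
  have \<sigma>: "P (c(b := y, a := s)) \<longleftrightarrow> \<sigma> y = s" for y s
    unfolding \<sigma>_def using latin[OF aF(1), of "c(b := y)"] by (metis (mono_tags, lifting) theI')
  have \<sigma>_ex1: "\<exists>!y. \<sigma> y = s" for s
    using latin[OF b(1), of "c(a := s)"] aF(2) unfolding \<sigma>[symmetric] by (simp add: fun_upd_twist)
  obtain q where q: "quasigroup j q"
    "\<And>xs. length xs = Suc j \<Longrightarrow> qpred q xs \<longleftrightarrow> P (assign c (as @ [b]) xs)"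
    by (rule quasigroup_assign[of "as @ [b]" j]) (use ab A b j_def in auto)
  have lenb: "length bs = Suc m - j" using j by simp
  obtain K where K: "quasigroup (Suc m - j) K"
    "\<And>xs. length xs = Suc (Suc m - j) \<Longrightarrow> qpred K xs \<longleftrightarrow> P (assign (c(a := \<sigma> (hd xs))) bs (tl xs))"
  proof (rule quasigroup_of_predicate[of "Suc m - j" "\<lambda>xs. P (assign (c(a := \<sigma> (hd xs))) bs (tl xs))"])
    fix xs :: "'a list" and i
    assume xs: "length xs = Suc (Suc m - j)" and i: "i < Suc (Suc m - j)"
    obtain z zs where xs_eq: "xs = z # zs" "length zs = length bs"
      using xs lenb by (cases xs) auto
    have a_bs: "a \<notin> set bs" using a ab by auto
    show "\<exists>!y. P (assign (c(a := \<sigma> (hd (xs[i := y])))) bs (tl (xs[i := y])))"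
    proof (cases i)
      case 0
      have "assign (c(a := s)) bs zs = (assign c bs zs)(a := s)" for s
      proof
        fix v
        show "assign (c(a := s)) bs zs v = ((assign c bs zs)(a := s)) v"
          using a_bs xs_eq ab(2)
          by (cases "v \<in> set bs") (auto simp: assign_other assign_nth in_set_conv_nth)
      qed
      moreover obtain s where "\<And>t. P ((assign c bs zs)(a := t)) \<longleftrightarrow> t = s"
        using latin[OF aF(1), of "assign c bs zs"] by auto
      ultimately show ?thesis using \<sigma>_ex1[of s] 0 by (simp add: xs_eq)
    next
      case (Suc l)
      then have l: "l < length bs" using i lenb by simp
      then have "bs ! l \<in> set fs" using ab by auto
      then show ?thesis
        using latin[of "bs ! l" "assign (c(a := \<sigma> z)) bs zs"] Suc l xs_eq ab
        by (simp add: assign_update)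
    qed
  qed (rule that)
  have "qpred Q xs \<longleftrightarrow>
      qpred K (q (map (\<lambda>i. xs ! \<eta> i) [0..<j]) # map (\<lambda>i. xs ! \<eta> i) [j..<Suc m])"
    if xs: "length xs = Suc m" for xs
  proof -
    define x where "x = assign c fs xs"
    have x: "map x fs = xs" "\<And>v. v \<notin> set fs \<Longrightarrow> x v = c v"
      using fs xs by (simp_all add: x_def map_assign assign_other)
    have perm: "xs ! \<eta> i = x ((as @ bs) ! i)" if "i < Suc m" for i
    proof -
      have "\<eta> i < Suc m" using permutes_in_image[OF \<eta>(1)] that by (metis lessThan_iff)
      then show ?thesis
        using \<eta> fs that x(1) by (metis nth_map permute_list_nth)
    qed
    have "map (\<lambda>i. xs ! \<eta> i) [0..<j] = map x as"
      by (rule nth_equalityI) (use perm j in \<open>auto simp: j_def nth_append\<close>)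
    moreover have "map (\<lambda>i. xs ! \<eta> i) [j..<Suc m] = map x bs"
      by (rule nth_equalityI) (use perm j in \<open>auto simp: j_def nth_append simp del: upt_Suc\<close>)
    moreover have "qpred K (q (map x as) # map x bs) \<longleftrightarrow> P x"
    proof -
      define y where "y = q (map x as)"
      \<comment> \<open>The points \<open>x\<close>, \<open>w\<close>, \<open>u\<close>,
        \<open>z\<close> form a rectangle with respect to \<open>A\<close> and its complement;
        \<open>w\<close> and \<open>u\<close> satisfy \<open>P\<close>, so \<open>x\<close> does iff
        \<open>z\<close> does.\<close>
      define w where "w = override_on (c(b := y)) x A"
      define u where "u = c(b := y, a := \<sigma> y)"
      define z where "z = override_on (c(a := \<sigma> y)) x (set bs)"
      have upd: "map (x(b := y)) (as @ [b]) = map x as @ [y]" using ab b by auto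
      have "assign c (as @ [b]) (map (x(b := y)) (as @ [b])) = w"
        unfolding assign_map w_def using ab b by (auto simp: override_on_def fun_eq_iff)
      then have "assign c (as @ [b]) (map x as @ [y]) = w" unfolding upd .
      moreover have "qpred q (map x as @ [y])" by (simp add: qpred_def y_def)
      ultimately have w: "P w" using q(2)[of "map x as @ [y]"] j_def by simp
      have u: "P u" using \<sigma> by (simp add: u_def)
      have off: "w v = c v" "u v = c v" "z v = c v" if "v \<notin> set fs" for v
        using that A(1) b aF ab x by (auto simp: w_def u_def z_def override_on_def)
      have z: "qpred K (y # map x bs) \<longleftrightarrow> P z"
        using K(2)[of "y # map x bs"] lenb by (simp add: assign_map z_def)
      have o: "override_on w z A = u" "override_on z w A = x"
        "override_on u x A = w" "override_on x u A = z"
        using a b A(1) ab x by (auto simp: w_def u_def z_def override_on_def fun_eq_iff)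
      have "P z" if "P x"
        by (rule splitsD[OF S, of w z]) (use off o u w that in auto)
      moreover have "P x" if "P z"
        by (rule splitsD[OF S, of u x]) (use off o u w x that in auto)
      ultimately show ?thesis using z unfolding y_def by blast
    qed
    ultimately show ?thesis using x(1) by (simp add: P_def)
  qed
  then show ?thesis
    unfolding reducible_def using \<eta>(1) j lb q(1) K(1)
    by (intro exI[of _ \<eta>] exI[of _ j] exI[of _ q] exI[of _ K]) auto
qed

section \<open>From the retract \<open>K\<close> of \<open>M\<close> to the decomposition into
  blocks\<close>

theorem theorem1:
  fixes n k :: nat and M K :: "'a list \<Rightarrow> 'a"
  assumes "n > 0"
    and "quasigroup (n - 1) M"
    and "k > 0"
    and "maximal_irreducible_retract (n - 1) M (k - 1) K"
    and "4 \<le> k" and "k + 3 \<le> n"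
  shows "\<exists>(Z :: nat \<Rightarrow> nat list) (q :: nat \<Rightarrow> 'a list \<Rightarrow> 'a).
    (\<forall>i<k. Z i \<noteq> [] \<and> distinct (Z i) \<and> set (Z i) \<subseteq> {..<n} \<and> quasigroup (length (Z i)) (q i)) \<and>
    (\<forall>i<k. \<forall>j<k. i \<noteq> j \<longrightarrow> set (Z i) \<inter> set (Z j) = {}) \<and>
    (\<forall>zs. length zs = n \<longrightarrow>
       (qpred M zs \<longleftrightarrow> qpred K (map (\<lambda>i. q i (map (\<lambda>j. zs ! j) (Z i))) [0..<k])))"
proof -
  note max = assms(4)[unfolded maximal_irreducible_retract_def]
  have n: "Suc (n - 1) = n" and k: "Suc (k - 1) = k" using assms by auto
  have qK: "quasigroup (k - 1) K" and irrK: "\<not> reducible (k - 1) K"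
    using max by (auto simp: irreducible_quasigroup_def)
  obtain I as where I: "I \<subseteq> {..<n}" "card I = k"
    and K: "\<And>xs. length xs = n \<Longrightarrow> (\<And>i. i < n \<Longrightarrow> i \<notin> I \<Longrightarrow> xs ! i = as ! i) \<Longrightarrow>
      qpred K (nths xs I) \<longleftrightarrow> qpred M xs"
    using max unfolding retract_def n k by metis
  \<comment> \<open>All \<open>n\<close> positions are treated alike, the last one being the output
    of \<open>M\<close>.\<close>
  define P where "P x = qpred M (map x [0..<n])" for x
  define ws where "ws S = nths [0..<n] S" for S
  have ws: "distinct (ws S)" for S by (simp add: ws_def)
  have ws_set: "set (ws S) = S" "length (ws S) = card S" if "S \<subseteq> {..<n}" for S
    using that by (simp_all add: ws_def set_nths_upt length_nths_upt)
  define c where "c = (\<lambda>v. as ! v)"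
  have K_eq: "qpred K (map x (ws I)) \<longleftrightarrow> P x" if "\<And>v. v < n \<Longrightarrow> v \<notin> I \<Longrightarrow> x v = c v" for x
    using K[of "map x [0..<n]"] that by (simp add: c_def P_def ws_def nths_map)
  interpret latin "{..<n}" P
    using quasigroup_latin[OF assms(2), of "[0..<n]"] n
    by (simp add: P_def[abs_def] atLeast0LessThan)
  interpret unsplit_core "{..<n}" P I c
  proof
    show "I \<subseteq> {..<n}" "4 \<le> card I" using I assms by auto
    show "\<not> splits P I A c" if "A \<subseteq> I" "2 \<le> card A" "2 \<le> card (I - A)" for A
    proof
      assume "splits P I A c"
      then have "splits (\<lambda>x. qpred K (map x (ws I))) I A c"
        by (rule splits_eq) (rule K_eq)
      then have "reducible (k - 1) K"
        using splits_reducible[OF qK ws, of I A c] that ws_set[OF I(1)] I(2) k by simp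
      then show False using irrK by simp
    qed
    show "\<exists>A\<subseteq>F. 2 \<le> card A \<and> 2 \<le> card (F - A) \<and> splits P F A d"
      if F: "I \<subset> F" "F \<subseteq> {..<n}" "card F \<le> card I + 2" for F d
    proof -
      define l where "l = card F - 1"
      have "k < card F"
        using psubset_card_mono[OF finite_subset[OF F(2)] F(1)] I by simp
      \<comment> \<open>\<open>l < n - 1\<close> is where \<open>k + 3 \<le> n\<close> enters: with
        two more free positions the retract is still proper. \<open>k \<le> l\<close> puts its arity
        above the \<open>k - 1\<close> of \<open>K\<close>, so maximality makes it
        reducible.\<close>
      then have l: "Suc l = card F" "k \<le> l" "l < n - 1"
        using F(3) I(2) assms by (auto simp: l_def)
      obtain q where q: "quasigroup l q"
        "\<And>xs. length xs = Suc l \<Longrightarrow> qpred q xs \<longleftrightarrow> P (assign d (ws F) xs)"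
        by (rule quasigroup_assign[of "ws F" l]) (use ws ws_set F l in auto)
      have "retract (n - 1) M l q"
        unfolding retract_def n
      proof (intro conjI exI[of _ F] exI[of _ "map d [0..<n]"] allI impI)
        fix xs :: "'a list"
        assume xs: "length xs = n" and eq: "\<forall>i<n. i \<notin> F \<longrightarrow> xs ! i = map d [0..<n] ! i"
        have xs_map: "map ((!) xs) [0..<n] = xs" using xs map_nth by blast
        then have nths_eq: "nths xs F = map ((!) xs) (ws F)"
          by (metis nths_map ws_def)
        have "qpred q (nths xs F) \<longleftrightarrow> P (override_on d ((!) xs) F)"
          unfolding nths_eq using q(2)[of "map ((!) xs) (ws F)"] ws_set[OF F(2)] l
          by (simp add: assign_map)
        also have "\<dots> \<longleftrightarrow> P ((!) xs)"
          by (rule P_cong) (use eq in \<open>auto simp: override_on_def\<close>)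
        finally show "qpred q (nths xs F) \<longleftrightarrow> qpred M xs" by (simp add: P_def xs_map)
      qed (use q l F in auto)
      then have "reducible l q"
        using max l q(1) assms(3) unfolding irreducible_quasigroup_def by fastforce
      then obtain A where A: "A \<subseteq> F" "2 \<le> card A" "2 \<le> card (F - A)"
        "splits (\<lambda>x. qpred q (map x (ws F))) F A d"
        using reducible_splits[OF _ ws, of l q F d] ws_set[OF F(2)] l by auto
      have "splits P F A d"
      proof (rule splits_eq[OF A(4)])
        fix x assume "\<And>v. v \<notin> F \<Longrightarrow> x v = d v"
        then have "override_on d x F = x" by (auto simp: override_on_def)
        then show "P x \<longleftrightarrow> qpred q (map x (ws F))"
          using q(2)[of "map x (ws F)"] ws_set[OF F(2)] l by (simp add: assign_map)
      qed
      then show ?thesis using A by blast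
    qed
  qed
  define r where "r i = ws I ! i" for i
  have r: "r i \<in> I" if "i < k" for i
    using that ws_set[OF I(1)] I(2) nth_mem[of i "ws I"] by (simp add: r_def)
  define Z where "Z i = ws (block (r i))" for i
  \<comment> \<open>\<open>block_op\<close> expects a whole assignment and reads it on
    \<open>set (Z i)\<close>; \<open>c\<close> fills the rest.\<close>
  define q where "q i vs = block_op c (r i) (assign c (Z i) vs)" for i vs
  have Z_set: "set (Z i) = block (r i)" for i
    unfolding Z_def by (rule ws_set(1)) (auto simp: block_def)
  have Z: "distinct (Z i)" for i by (simp add: Z_def ws)
  show ?thesis
  proof (intro exI[of _ Z] exI[of _ q] conjI allI impI)
    fix i assume i: "i < k"
    show "Z i \<noteq> []" using Z_set[of i] block_I[OF r[OF i]] by auto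
    show "distinct (Z i)" by (rule Z)
    show "set (Z i) \<subseteq> {..<n}" by (auto simp: Z_set block_def)
    show "quasigroup (length (Z i)) (q i)"
      unfolding quasigroup_def
    proof (intro allI impI)
      fix xs :: "'a list" and p
      assume xs: "length xs = Suc (length (Z i))" and p: "p < Suc (length (Z i))"
      obtain vs z where vs: "xs = vs @ [z]" "length vs = length (Z i)"
        using xs by (auto simp: length_Suc_conv_rev)
      show "\<exists>!y. qpred (q i) (xs[p := y])"
      \<comment> \<open>A position inside \<open>Z i\<close> is solved for by
        \<open>block_op_latin\<close>; the remaining one is the output.\<close>
      proof (cases "p < length (Z i)")
        case True
        then have "Z i ! p \<in> block (r i)" using Z_set nth_mem by metis
        from block_op_latin[OF r[OF i] this, of c "assign c (Z i) vs" z] show ?thesis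
          using True vs by (simp add: qpred_def q_def list_update_append assign_update[OF Z])
      next
        case False
        then have "p = length vs" using p vs by simp
        then show ?thesis using vs by (simp add: qpred_def list_update_append)
      qed
    qed
  next
    fix i j assume "i < k" "j < k" "i \<noteq> j"
    then have "r i \<noteq> r j"
      using ws_set[OF I(1)] I(2) ws by (simp add: r_def nth_eq_iff_index_eq)
    then show "set (Z i) \<inter> set (Z j) = {}" by (auto simp: Z_set block_def)
  next
    fix zs :: "'a list" assume zs: "length zs = n"
    define x where "x = (\<lambda>v. zs ! v)"
    have "map x [0..<n] = zs" using zs map_nth by (metis x_def)
    then have "qpred M zs \<longleftrightarrow> P x" by (simp add: P_def)
    also have "\<dots> \<longleftrightarrow> P (\<lambda>v. if v \<in> I then block_op c v x else c v)" by (rule decomposition)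
    \<comment> \<open>The blocks were reset to the very values fixed in \<open>K\<close>, so the
      assignment equals \<open>c\<close> off \<open>I\<close> and the retract applies.\<close>
    also have "\<dots> \<longleftrightarrow> qpred K (map (\<lambda>v. if v \<in> I then block_op c v x else c v) (ws I))"
      by (rule K_eq[symmetric]) simp
    also have "map (\<lambda>v. if v \<in> I then block_op c v x else c v) (ws I) =
        map (\<lambda>i. q i (map x (Z i))) [0..<k]"
    proof (rule nth_equalityI)
      show "length (map (\<lambda>v. if v \<in> I then block_op c v x else c v) (ws I)) =
          length (map (\<lambda>i. q i (map x (Z i))) [0..<k])"
        using ws_set[OF I(1)] I(2) by simp
      fix i assume "i < length (map (\<lambda>v. if v \<in> I then block_op c v x else c v) (ws I))"
      then have i: "i < k" "i < length (ws I)" using ws_set[OF I(1)] I(2) by simp_all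
      have "q i (map x (Z i)) = block_op c (r i) x"
        unfolding q_def assign_map Z_set by (rule block_op_cong) simp
      then show "map (\<lambda>v. if v \<in> I then block_op c v x else c v) (ws I) ! i =
          map (\<lambda>i. q i (map x (Z i))) [0..<k] ! i"
        using i r[OF i(1)] by (simp add: r_def)
    qed
    finally show "qpred M zs \<longleftrightarrow> qpred K (map (\<lambda>i. q i (map (\<lambda>j. zs ! j) (Z i))) [0..<k])"
      by (simp add: x_def)
  qed
qed

end
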